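(* (a) Every integer $m\ge 122$ can be written as $m=p_1+\dots+p_k$ for some $k\ge 1$ and pairwise distinct primes $p_1,\dots,p_k$, each congruent to $1$ modulo $4$. (b) Every integer $m\ge 56$ can be written as $m=q_1+\dots+q_\ell$ for some $\ell\ge 1$ and pairwise distinct primes $q_1,\dots,q_\ell$, each congruent to $3$ modulo $4$. *)

theory Defs
  imports "HOL-Computational_Algebra.Primes"
begin

end

theory Submission
  imports Defs "HOL-Number_Theory.Prime_Powers" "HOL-Library.Discrete_Functions"
begin

text \<open>
  Let \<open>\<chi>\<^sub>0\<close> and \<open>\<chi>\<^sub>4\<close> be the characters modulo 4 and put \<open>T\<^sub>i(N) = \<Sum>n\<le>N. \<chi>\<^sub>i(n) ln n\<close>. Writing
  \<open>ln = \<Lambda> * 1\<close>, the combination \<open>T\<^sub>0(N) - 2 T\<^sub>0(N/2) \<plusminus> T\<^sub>4(N)\<close> becomes a sum over \<open>\<Lambda>(d)\<close>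
  whose coefficients are at most 2 on one class modulo 4 and at most 0 on the other, while it is
  \<open>(N/2) ln 2 + O(ln N)\<close> by the size of the central binomial coefficients. Hence
  each class contains at least \<open>\<surd>N\<close> primes up to \<open>N\<close> once \<open>N \<ge> 2^14\<close>, and the sum of the primes
  of the class up to \<open>x\<close> exceeds \<open>x\<close> by a margin. So each further prime \<open>q\<close> of the class is
  small compared with the sum of the previous ones, and the interval of representable numbers
  overlaps its translate by \<open>q\<close>: the interval grows with every prime (Richert's argument). A finite
  computation starts the induction.
\<close>

section \<open>Logarithmic sums over the characters modulo 4\<close>

text \<open>Expand \<open>ln n\<close> as the sum of \<open>mangoldt d\<close> over
  \<open>d dvd n\<close>, put \<open>n = d * m\<close> and exchange the sums; complete
  multiplicativity pulls \<open>w d\<close> out.\<close>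

lemma sum_multiplicative_mult_ln:
  fixes w :: "nat \<Rightarrow> real"
  assumes w: "\<And>a b. w (a * b) = w a * w b"
  shows "(\<Sum>n=1..N. w n * ln (real n)) =
    (\<Sum>d=1..N. w d * mangoldt d * (\<Sum>m=1..N div d. w m))"
proof -
  have "(\<Sum>n=1..N. w n * ln (real n)) = (\<Sum>n=1..N. \<Sum>d | d dvd n. w n * mangoldt d)"
    by (rule sum.cong) (simp_all add: sum_distrib_left [symmetric] mangoldt_sum)
  also have "\<dots> = (\<Sum>(n, d)\<in>(SIGMA n:{1..N}. {d. d dvd n}). w n * mangoldt d)"
    by (rule sum.Sigma) (auto intro: finite_divisors_nat)
  also have "\<dots> = (\<Sum>(d, m)\<in>(SIGMA d:{1..N}. {1..N div d}). w d * mangoldt d * w m)"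
  proof -
    have "b \<le> N" if "b * k \<le> N" "0 < k" for b k
      using that by (metis One_nat_def Suc_leI le_trans mult_le_mono2 nat_mult_1_right)
    then show ?thesis
      by (intro sum.reindex_bij_witness
          [where i = "\<lambda>(d, m). (d * m, d)" and j = "\<lambda>(n, d). (d, n div d)"])
        (auto simp: w Suc_le_eq less_eq_div_iff_mult_less_eq mult.commute div_le_mono
          intro: Nat.gr0I elim!: dvdE)
  qed
  also have "\<dots> = (\<Sum>d=1..N. \<Sum>m=1..N div d. w d * mangoldt d * w m)"
    by (rule sum.Sigma [symmetric]) auto
  finally show ?thesis
    by (simp add: sum_distrib_left)
qed

definition chi0 :: "nat \<Rightarrow> real" where
  "chi0 n = (if odd n then 1 else 0)"

definition chi4 :: "nat \<Rightarrow> real" where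
  "chi4 n = (if n mod 4 = 1 then 1 else if n mod 4 = 3 then -1 else 0)"

lemma chi0_mult: "chi0 (a * b) = chi0 a * chi0 b"
  by (simp add: chi0_def)

lemma chi4_mult: "chi4 (a * b) = chi4 a * chi4 b"
proof -
  have "a mod 4 \<in> {0, 1, 2, 3}" "b mod 4 \<in> {0, 1, 2, 3}" by auto
  moreover have "(a * b) mod 4 = ((a mod 4) * (b mod 4)) mod 4"
    by (simp add: mod_mult_eq)
  ultimately show ?thesis by (auto simp: chi4_def)
qed

lemma sum_chi0: "(\<Sum>m=1..n. chi0 m) = real ((n + 1) div 2)"
  by (induction n) (auto simp: chi0_def elim!: oddE evenE)

lemma sum_chi4: "(\<Sum>m=1..n. chi4 m) = (if n mod 4 = 1 \<or> n mod 4 = 2 then 1 else 0)"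
proof (induction n)
  case (Suc n)
  have "n mod 4 \<in> {0, 1, 2, 3}" by auto
  with Suc show ?case by (auto simp: chi4_def mod_Suc)
qed auto

text \<open>The product of the odd numbers below \<open>2 * k\<close> is
  \<open>fact (2 * k) / (2 ^ k * fact k)\<close>.\<close>

lemma sum_chi0_ln:
  "(\<Sum>n=1..2*k. chi0 n * ln (real n)) = ln (fact (2 * k)) - real k * ln 2 - ln (fact k)"
proof (induction k)
  case (Suc k)
  have "fact (2 * Suc k) = real (2 * k + 2) * (real (2 * k + 1) * fact (2 * k))"
    by (simp add: algebra_simps)
  then have "ln (fact (2 * Suc k) :: real) =
      ln (real (2 * k + 2)) + (ln (real (2 * k + 1)) + ln (fact (2 * k)))"
    by (simp only:) (subst ln_mult; simp)+
  moreover have "ln (real (2 * k + 2)) = ln 2 + ln (real (Suc k))"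
    using ln_mult [of 2 "real (Suc k)"] by (simp add: algebra_simps)
  moreover have "ln (fact (Suc k) :: real) = ln (real (Suc k)) + ln (fact k)"
    by (simp add: ln_mult del: of_nat_Suc)
  ultimately show ?case
    using Suc by (simp add: chi0_def algebra_simps)
qed auto

text \<open>Each block of four adds \<open>ln (4j+1) - ln (4j+3)\<close>, which is negative;
  successive blocks interlace, so the losses telescope to at most one logarithm.\<close>

lemma sum_chi4_ln_bounds:
  "- ln (real (4 * k)) \<le> (\<Sum>n=1..4*k. chi4 n * ln (real n)) \<and>
    (\<Sum>n=1..4*k. chi4 n * ln (real n)) \<le> 0"
proof (induction k)
  case (Suc k)
  have chi: "chi4 (Suc (4 * k)) = 1" "chi4 (Suc (Suc (4 * k))) = 0"
    "chi4 (Suc (Suc (Suc (4 * k)))) = -1" "chi4 (Suc (Suc (Suc (Suc (4 * k))))) = 0"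
    by (simp_all add: chi4_def mod_Suc)
  have "4 * Suc k = Suc (Suc (Suc (Suc (4 * k))))" by simp
  then have "(\<Sum>n=1..4*Suc k. chi4 n * ln (real n)) =
      (\<Sum>n=1..4*k. chi4 n * ln (real n)) + ln (real (4 * k + 1)) - ln (real (4 * k + 3))"
    by (simp only: chi sum.cl_ivl_Suc) (simp add: add.commute)
  moreover have "ln (real (4 * k + 1)) \<le> ln (real (4 * k + 3))"
    "ln (real (4 * k + 3)) \<le> ln (real (4 * Suc k))" by (subst ln_le_cancel_iff; simp)+
  \<comment> \<open>At \<open>k = 0\<close> this rests on the convention
    \<open>ln 0 = 0\<close>.\<close>
  moreover have "ln (real (4 * k)) \<le> ln (real (4 * k + 1))" by (cases "k = 0") simp_all
  ultimately show ?case using Suc by linarith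
qed auto

section \<open>Chebyshev bound for the von Mangoldt function on a class\<close>

text \<open>With \<open>y = N div d\<close> this is the coefficient that
  \<open>T0 N - 2 * T0 (N div 2)\<close> gives to an odd \<open>d\<close>. It is nonzero exactly
  where the partial sum of \<open>chi4\<close> is 1, so adding that sum yields 2 and 0, subtracting
  it 0 and -2.\<close>

lemma odd_count_diff:
  "real ((y + 1) div 2) - 2 * real ((y div 2 + 1) div 2) =
    (if y mod 4 = 1 then 1 else if y mod 4 = 2 then -1 else 0)"
proof -
  define q where "q = y div 4"
  have "y mod 4 \<in> {0, 1, 2, 3}" by auto
  moreover have "y = 4 * q + y mod 4" by (simp add: q_def)
  ultimately have "y \<in> {4 * q, 4 * q + 1, 4 * q + 2, 4 * q + 3}" by auto
  moreover have "(4 * q + 1) div 2 = 2 * q" "(4 * q + 2) div 2 = 2 * q + 1"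
    "(4 * q + 3) div 2 = 2 * q + 1" "(4 * q + 4) div 2 = 2 * q + 2"
    "(2 * q + 1) div 2 = q" "(2 * q + 2) div 2 = q + 1" "(4 * q) div 2 = 2 * q"
    by presburger+
  moreover have "(4 * q + 1) mod 4 = 1" "(4 * q + 2) mod 4 = 2" "(4 * q + 3) mod 4 = 3"
    by presburger+
  ultimately show ?thesis by (auto simp: add.assoc)
qed

text \<open>The binomial coefficients contribute at least
  \<open>4 k ln 2 - ln (4 k) - 2 k ln 2\<close>, the \<open>chi4\<close> sum costs at most another
  \<open>ln (4 k)\<close>, and the coefficient 2 on the class is divided out at the end.\<close>

lemma sum_mangoldt_mod_4_ge:
  assumes a: "a = 1 \<or> a = 3" and k: "0 < k"
  shows "real k * ln 2 - ln (real (4 * k)) \<le>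
    (\<Sum>d | d \<le> 4 * k \<and> d mod 4 = a. mangoldt d)"
proof -
  define N where "N = 4 * k"
  define T0 where "T0 M = (\<Sum>n=1..M. chi0 n * ln (real n))" for M
  define T1 where "T1 = (\<Sum>n=1..N. chi4 n * ln (real n))"
  have "T0 (2 * (2 * k)) - 2 * T0 (2 * k) = ln ((4 * k) choose (2 * k)) - ln ((2 * k) choose k)"
  proof -
    have "ln (fact (2 * m) :: real) = 2 * ln (fact m) + ln ((2 * m) choose m)" for m
    proof -
      have "(fact (2 * m) :: real) = fact m * fact m * ((2 * m) choose m)"
        using binomial_fact [of m "2 * m", where ?'a = real] by (simp add: mult_2)
      then show ?thesis by (simp add: ln_mult)
    qed
    from this [of k] this [of "2 * k"]
    have "ln (fact (4 * k) :: real) = 2 * ln (fact (2 * k)) + ln ((4 * k) choose (2 * k))"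
      "ln (fact (2 * k) :: real) = 2 * ln (fact k) + ln ((2 * k) choose k)"
      by simp_all
    then show ?thesis
      unfolding T0_def sum_chi0_ln by simp
  qed
  moreover have "ln ((4 * k) choose (2 * k)) \<ge> 2 * real k * ln 2 + real (2 * k) * ln 2 - ln (real N)"
  proof -
    have "ln (4 ^ (2 * k) / real N) \<le> ln ((4 * k) choose (2 * k))"
      using central_binomial_lower_bound [of "2 * k"] k
      by (subst ln_le_cancel_iff) (simp_all add: N_def)
    moreover have "ln (4 :: real) = 2 * ln 2"
      using ln_realpow [of "2::real" 2] by simp
    ultimately show ?thesis
      using k by (simp add: N_def ln_div ln_realpow)
  qed
  moreover have "ln ((2 * k) choose k) \<le> 2 * real k * ln 2"
  proof -
    have "real ((2 * k) choose k) \<le> 2 ^ (2 * k)"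
      using binomial_le_pow2 [of "2 * k" k] by (metis of_nat_le_iff of_nat_numeral of_nat_power)
    then have "ln ((2 * k) choose k) \<le> ln (2 ^ (2 * k) :: real)"
      by (subst ln_le_cancel_iff) simp_all
    then show ?thesis by (simp add: ln_realpow)
  qed
  moreover have "chi4 a * T1 \<ge> - ln (real N)"
    using a sum_chi4_ln_bounds [of k] k unfolding T1_def N_def chi4_def by (auto simp: ln_ge_zero)
  ultimately have lower: "2 * (real k * ln 2 - ln (real N)) \<le> T0 N - 2 * T0 (2 * k) + chi4 a * T1"
    by (simp add: N_def)
  have T0: "T0 M = (\<Sum>d=1..M. chi0 d * mangoldt d * real ((M div d + 1) div 2))" for M
    unfolding T0_def sum_multiplicative_mult_ln [OF chi0_mult] sum_chi0 ..
  have "T0 (2 * k) = (\<Sum>d=1..N. chi0 d * mangoldt d * real ((2 * k div d + 1) div 2))"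
    \<comment> \<open>For \<open>d\<close> above \<open>2 * k\<close> the quotient is 0 and
      \<open>(0 + 1) div 2 = 0\<close>, so the range extends to \<open>N\<close>.\<close>
    unfolding T0 by (rule sum.mono_neutral_left) (auto simp: N_def)
  also have "\<dots> = (\<Sum>d=1..N. chi0 d * mangoldt d * real ((N div d div 2 + 1) div 2))"
  proof -
    have "2 * k div d = N div d div 2" for d
      by (simp add: N_def div_mult2_eq [symmetric] mult.commute [of 2])
    then show ?thesis by simp
  qed
  finally have "T0 N - 2 * T0 (2 * k) + chi4 a * T1 = (\<Sum>d=1..N. mangoldt d *
      (chi0 d * (real ((N div d + 1) div 2) - 2 * real ((N div d div 2 + 1) div 2)) +
       chi4 a * chi4 d * (if N div d mod 4 = 1 \<or> N div d mod 4 = 2 then 1 else 0)))"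
    unfolding T0 [of N] T1_def sum_multiplicative_mult_ln [OF chi4_mult] sum_chi4
    by (simp add: sum_distrib_left sum.distrib [symmetric] sum_subtractf [symmetric] algebra_simps)
  also have "\<dots> \<le> (\<Sum>d=1..N. mangoldt d * (if d mod 4 = a then 2 else 0))"
  proof (intro sum_mono mult_left_mono mangoldt_nonneg)
    fix d :: nat
    have "d mod 4 \<in> {0, 1, 2, 3}" by auto
    moreover have "odd d \<longleftrightarrow> d mod 4 = 1 \<or> d mod 4 = 3" by presburger
    ultimately show "chi0 d * (real ((N div d + 1) div 2) - 2 * real ((N div d div 2 + 1) div 2)) +
       chi4 a * chi4 d * (if N div d mod 4 = 1 \<or> N div d mod 4 = 2 then 1 else 0)
       \<le> (if d mod 4 = a then 2 else 0)"
      unfolding odd_count_diff using a by (auto simp: chi0_def chi4_def)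
  qed
  also have "\<dots> = (\<Sum>d | d \<le> N \<and> d mod 4 = a. mangoldt d * 2)"
    using a by (intro sum.mono_neutral_cong_right) (auto intro: Nat.gr0I simp: Suc_le_eq)
  finally show ?thesis
    using lower by (simp add: sum_distrib_right [symmetric] N_def)
qed

section \<open>From prime powers to primes\<close>

text \<open>At most \<open>log p N\<close> powers of \<open>p\<close> lie up to \<open>N\<close>,
  each of weight \<open>ln p\<close>. The subset \<open>D\<close> allows for powers that fall
  outside the class.\<close>

lemma sum_mangoldt_same_prime_le:
  assumes p: "prime p" and N: "0 < N"
    and D: "D \<subseteq> {d. d \<le> N \<and> primepow d \<and> aprimedivisor d = p}"
  shows "(\<Sum>d\<in>D. mangoldt d) \<le> ln (real N)"
proof -
  define K where "K = {i. 0 < i \<and> p ^ i \<le> N}"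
  have p1: "1 < p" using p by (rule prime_gt_1_nat)
  have finK: "finite K"
  proof (rule finite_subset)
    show "K \<subseteq> {..N}"
      using power_gt_expt [of p] p1 unfolding K_def by (auto intro: less_imp_le order_trans)
  qed simp
  have "D \<subseteq> (\<lambda>i. p ^ i) ` K"
  proof
    fix d assume "d \<in> D"
    then have d: "d \<le> N" "primepow d" "aprimedivisor d = p" using D by auto
    then obtain q i where "prime q" "0 < i" "d = q ^ i" by (auto simp: primepow_def)
    with d show "d \<in> (\<lambda>i. p ^ i) ` K"
      by (auto simp: K_def aprimedivisor_prime_power)
  qed
  then have "(\<Sum>d\<in>D. mangoldt d) \<le> (\<Sum>d\<in>(\<lambda>i. p ^ i) ` K. mangoldt d :: real)"
    using finK by (intro sum_mono2) (auto simp: mangoldt_nonneg)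
  also have "\<dots> \<le> (\<Sum>i\<in>K. mangoldt (p ^ i))"
    using finK p1 by (subst sum.reindex) (auto intro!: inj_onI dest: power_inject_exp [THEN iffD1, rotated])
  also have "\<dots> = real (card K) * ln (real p)"
    using p by (simp add: K_def)
  also have "\<dots> \<le> ln (real N)"
  proof (cases "K = {}")
    case False
    then have "Max K \<in> K" using finK by simp
    then have "p ^ Max K \<le> N" by (simp add: K_def)
    have "card K \<le> card {1..Max K}"
      using finK by (intro card_mono) (auto simp: K_def Suc_le_eq)
    then have "real (card K) * ln (real p) \<le> real (Max K) * ln (real p)"
      using p1 by (intro mult_right_mono) auto
    also have "\<dots> = ln (real (p ^ Max K))"
      using p1 by (simp add: ln_realpow)
    also have "\<dots> \<le> ln (real N)"
      using \<open>p ^ Max K \<le> N\<close> p1 N by (subst ln_le_cancel_iff) (auto simp del: of_nat_power)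
    finally show ?thesis .
  qed (use N in simp)
  finally show ?thesis .
qed

definition primes_mod4 :: "nat \<Rightarrow> nat \<Rightarrow> nat set" where
  "primes_mod4 a x = {p. prime p \<and> p mod 4 = a \<and> p \<le> x}"

lemma finite_primes_mod4 [simp]: "finite (primes_mod4 a x)"
  by (rule finite_subset [of _ "{..x}"]) (auto simp: primes_mod4_def)

text \<open>Each prime base contributes at most \<open>ln N\<close>. A base occurring with exponent
  1 is itself in the class; any other is at most \<open>sqrt N\<close>, whatever its own
  residue.\<close>

lemma sum_mangoldt_mod_4_le:
  assumes N: "0 < N"
  shows "(\<Sum>d | d \<le> N \<and> d mod 4 = a. mangoldt d) \<le>
    real (floor_sqrt N + card (primes_mod4 a N)) * ln (real N)"
proof -
  define D where "D = {d. d \<le> N \<and> d mod 4 = a \<and> primepow d}"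
  have finD: "finite D" by (simp add: D_def)
  have "(\<Sum>d | d \<le> N \<and> d mod 4 = a. mangoldt d :: real) = (\<Sum>d\<in>D. mangoldt d)"
    unfolding D_def by (rule sum.mono_neutral_right) (auto simp: mangoldt_def)
  also have "\<dots> = (\<Sum>p\<in>aprimedivisor ` D. \<Sum>d | d \<in> D \<and> aprimedivisor d = p. mangoldt d)"
    using finD by (rule sum.image_gen)
  also have "\<dots> \<le> (\<Sum>p\<in>aprimedivisor ` D. ln (real N))"
  proof (rule sum_mono)
    fix p assume "p \<in> aprimedivisor ` D"
    then have "prime p"
      by (auto simp: D_def primepow_def aprimedivisor_prime_power)
    then show "(\<Sum>d | d \<in> D \<and> aprimedivisor d = p. mangoldt d) \<le> ln (real N)"
      using N by (rule sum_mangoldt_same_prime_le) (auto simp: D_def)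
  qed
  also have "\<dots> = real (card (aprimedivisor ` D)) * ln (real N)" by simp
  also have "\<dots> \<le> real (floor_sqrt N + card (primes_mod4 a N)) * ln (real N)"
  proof (intro mult_right_mono of_nat_mono)
    have "aprimedivisor ` D \<subseteq> {1..floor_sqrt N} \<union> primes_mod4 a N"
    proof
      fix q assume "q \<in> aprimedivisor ` D"
      then obtain p i where pi: "prime p" "0 < i" "q = p" "p ^ i \<le> N" "p ^ i mod 4 = a"
        by (auto simp: D_def primepow_def aprimedivisor_prime_power)
      show "q \<in> {1..floor_sqrt N} \<union> primes_mod4 a N"
      proof (cases "i = 1")
        case False
        then have "p ^ 2 \<le> p ^ i"
          using pi prime_gt_0_nat [OF \<open>prime p\<close>] by (intro power_increasing) auto
        then have "p \<le> floor_sqrt N"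
          using pi by (simp add: le_floor_sqrt_iff)
        then show ?thesis using pi prime_gt_0_nat [of p] by auto
      qed (use pi in \<open>auto simp: primes_mod4_def\<close>)
    qed
    then have "card (aprimedivisor ` D) \<le> card ({1..floor_sqrt N} \<union> primes_mod4 a N)"
      by (intro card_mono) auto
    also have "\<dots> \<le> floor_sqrt N + card (primes_mod4 a N)"
      using card_Un_le [of "{1..floor_sqrt N}" "primes_mod4 a N"] by simp
    finally show "card (aprimedivisor ` D) \<le> floor_sqrt N + card (primes_mod4 a N)" .
  qed (use N in auto)
  finally show ?thesis .
qed

text \<open>With \<open>s = sqrt N\<close> and fewer than \<open>s\<close> primes, the two bounds on
  the \<open>mangoldt\<close> sum give \<open>s^2 ln 2 <= 4 (4 s + 2) ln s\<close>, which fails from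
  \<open>s = 128\<close> on.\<close>

lemma sqrt_le_card_primes_mod4:
  assumes a: "a = 1 \<or> a = 3" and k: "4096 \<le> k"
  shows "sqrt (real (4 * k)) \<le> real (card (primes_mod4 a (4 * k)))"
proof (rule ccontr)
  define s where "s = sqrt (real (4 * k))"
  define r where "r = real (floor_sqrt (4 * k))"
  define K where "K = real (card (primes_mod4 a (4 * k)))"
  have s_sq: "s * s = 4 * real k" by (simp add: s_def)
  have s: "128 \<le> s"
    unfolding s_def using k by (intro real_le_rsqrt) simp
  assume "\<not> ?thesis"
  then have "K < s" by (simp add: K_def s_def)
  moreover have "r \<le> s"
    unfolding s_def r_def
    by (rule real_le_rsqrt) (metis floor_sqrt_power2_le of_nat_le_iff of_nat_power)
  ultimately have "r + K \<le> 2 * s" by simp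
  have ln2: "1 / 2 \<le> ln (2 :: real)" "ln (2 :: real) \<le> 1"
    using ln_le_minus_one [of "1 / 2 :: real"] ln_2_less_1 by (simp_all add: ln_div)
  have ln_N: "ln (real (4 * k)) = 2 * ln s"
    using s s_sq ln_mult [of s s] by simp
  \<comment> \<open>tangent of \<open>ln\<close> at 128\<close>
  have ln_s: "ln s \<le> 7 * ln 2 + (s / 128 - 1)"
  proof -
    have "ln (s / 128) \<le> s / 128 - 1" using s by (intro ln_le_minus_one) simp
    moreover have "ln (128 :: real) = 7 * ln 2" using ln_realpow [of "2::real" 7] by simp
    ultimately show ?thesis using s by (simp add: ln_div)
  qed
  have "real k * ln 2 - 2 * ln s \<le> (r + K) * (2 * ln s)"
    using order_trans [OF sum_mangoldt_mod_4_ge [OF a, of k] sum_mangoldt_mod_4_le [of "4 * k" a]] k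
    unfolding ln_N by (simp add: r_def K_def)
  also have "\<dots> \<le> (2 * s) * (2 * ln s)"
    using \<open>r + K \<le> 2 * s\<close> s by (intro mult_right_mono) auto
  finally have "real k * ln 2 \<le> (4 * s + 2) * ln s" by (simp add: algebra_simps)
  also have "\<dots> \<le> (4 * s + 2) * (7 * ln 2 + (s / 128 - 1))"
    using s ln_s by (intro mult_left_mono) auto
  finally have "s * s * ln 2 \<le> 4 * ((4 * s + 2) * (7 * ln 2 + (s / 128 - 1)))"
    unfolding s_sq by linarith
  \<comment> \<open>The quadratic terms have total coefficient \<open>ln 2 - 1/8\<close>; replacing
    one factor \<open>s\<close> by 128 leaves an inequality linear in \<open>s\<close>.\<close>
  moreover have "0 \<le> (s - 128) * s * (ln 2 - 1 / 8)" "s * (1 / 2) \<le> s * ln 2"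
    using s ln2 by (auto intro!: mult_nonneg_nonneg)
  ultimately show False using s ln2 by (simp only: algebra_simps add_divide_distrib)
qed

section \<open>Sum of the primes of a class\<close>

text \<open>The quotients by 4 are distinct naturals, so they sum to at least
  \<open>0 + ... + (n - 1)\<close> with \<open>n = card A\<close>.\<close>

lemma sum_ge_if_same_mod_4:
  fixes A :: "nat set"
  assumes A: "\<And>p. p \<in> A \<Longrightarrow> p mod 4 = a"
  shows "2 * (card A * (card A - 1)) \<le> \<Sum>A"
proof -
  have "p div 4 = q div 4 \<Longrightarrow> p = q" if "p \<in> A" "q \<in> A" for p q
    using A [OF that(1)] A [OF that(2)] by (metis div_mult_mod_eq)
  then have inj: "inj_on (\<lambda>p. p div 4) A" by (intro inj_onI)
  have "2 * \<Sum>{0..<n} = n * (n - 1)" for n :: nat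
  proof (induction n)
    case (Suc n)
    then show ?case by (cases n) (auto simp: algebra_simps)
  qed simp
  then have "2 * (card A * (card A - 1)) = 4 * \<Sum>{0..<card ((\<lambda>p. p div 4) ` A)}"
    using inj by (simp add: card_image flip: mult.assoc)
  also have "\<dots> \<le> 4 * \<Sum>((\<lambda>p. p div 4) ` A)"
    by (intro mult_left_mono card_sum_le_nat_sum) simp
  also have "\<dots> = (\<Sum>p\<in>A. 4 * (p div 4))"
    using inj by (simp add: sum.reindex sum_distrib_left)
  also have "\<dots> \<le> \<Sum>A"
    by (intro sum_mono) simp
  finally show ?thesis .
qed

text \<open>About \<open>sqrt x\<close> elements of one class already sum to roughly
  \<open>2 * x\<close>. The margin 1000 pays for the term \<open>2 * L\<close> in
  \<open>covers_insert\<close>.\<close>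

lemma sum_primes_mod4_ge:
  assumes a: "a = 1 \<or> a = 3" and x: "16384 \<le> x"
  shows "x + 1000 \<le> \<Sum>(primes_mod4 a x)"
proof -
  define k where "k = x div 4"
  define K where "K = card (primes_mod4 a (4 * k))"
  have k: "4096 \<le> k" "x < 4 * k + 4" using x by (auto simp: k_def)
  have "sqrt (real (4 * k)) \<le> real K"
    unfolding K_def by (rule sqrt_le_card_primes_mod4) fact+
  then have "real (4 * k) \<le> real (K ^ 2)"
    by (metis of_nat_0_le_iff of_nat_power real_sqrt_le_iff real_sqrt_abs2 real_sqrt_pow2_iff
        sqrt_le_D)
  then have K_sq: "4 * k \<le> K * K" by (metis of_nat_le_iff power2_eq_square)
  have "128 \<le> K"
  proof (rule ccontr)
    assume "\<not> 128 \<le> K"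
    then have "K * K \<le> 127 * 127" by (intro mult_mono) auto
    with K_sq k show False by simp
  qed
  then have "128 * K \<le> K * K" by (intro mult_right_mono) auto
  moreover have "K * (K - 1) = K * K - K" by (simp add: diff_mult_distrib2)
  ultimately have "x + 1000 \<le> 2 * (K * (K - 1))"
    using K_sq k \<open>128 \<le> K\<close> by linarith
  also have "\<dots> \<le> \<Sum>(primes_mod4 a (4 * k))"
    unfolding K_def by (rule sum_ge_if_same_mod_4 [of _ a]) (simp add: primes_mod4_def)
  also have "\<dots> \<le> \<Sum>(primes_mod4 a x)"
    by (rule sum_mono2) (auto simp: primes_mod4_def k_def)
  finally show ?thesis .
qed

section \<open>Growing the interval of subset sums\<close>

text \<open>
  Subset sums are symmetric under \<open>m \<mapsto> \<Sum>A - m\<close>, so a gap below \<open>L\<close> forces one of the same length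
  at the top.
\<close>
definition covers :: "nat \<Rightarrow> nat set \<Rightarrow> bool" where
  "covers L A \<longleftrightarrow> finite A \<and> (\<forall>m. L \<le> m \<and> m + L \<le> \<Sum>A \<longrightarrow> m \<in> Sum ` Pow A)"

text \<open>With \<open>S\<close> the sum of \<open>A\<close>, the interval from \<open>L\<close> to
  \<open>S - L\<close> and its translate by \<open>q\<close> leave no integer between them if
  \<open>L + q <= S - L + 1\<close>; the \<open>Suc\<close> lets them be merely adjacent.\<close>

lemma covers_insert:
  assumes A: "covers L A" and q: "2 * L + q \<le> Suc (\<Sum>A)"
  shows "covers L (insert q A)"
proof (cases "q \<in> A")
  case False
  have fin: "finite A" using A by (simp add: covers_def)
  have "m \<in> Sum ` Pow (insert q A)" if m: "L \<le> m" "m + L \<le> \<Sum>(insert q A)" for m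
  proof (cases "m + L \<le> \<Sum>A")
    case True
    then have "m \<in> Sum ` Pow A" using A m by (simp add: covers_def)
    then show ?thesis by auto
  next
    case larger: False
    then have "L \<le> m - q" "m - q + L \<le> \<Sum>A" "q \<le> m"
      using q m fin False by auto
    then obtain P where P: "P \<subseteq> A" "\<Sum>P = m - q" using A by (auto simp: covers_def)
    then have "\<Sum>(insert q P) = m"
      using fin False \<open>q \<le> m\<close> by (subst sum.insert) (auto intro: finite_subset)
    with P show ?thesis by (intro image_eqI [of _ _ "insert q P"]) auto
  qed
  then show ?thesis using fin by (simp add: covers_def)
qed (use A in \<open>simp add: insert_absorb\<close>)

text \<open>Sums only grow, so comparing each \<open>t\<close> with the original \<open>A\<close>
  suffices and the order of insertion is immaterial.\<close>

lemma covers_Un: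
  assumes A: "covers L A" and T: "finite T" "\<And>t. t \<in> T \<Longrightarrow> 2 * L + t \<le> Suc (\<Sum>A)"
  shows "covers L (A \<union> T)"
  using T
proof (induction T rule: finite_induct)
  case (insert t T)
  have "\<Sum>A \<le> \<Sum>(A \<union> T)"
    using A insert by (intro sum_mono2) (auto simp: covers_def)
  moreover have "2 * L + t \<le> Suc (\<Sum>A)" using insert by simp
  ultimately have "covers L (insert t (A \<union> T))"
    using insert.IH insert.prems by (intro covers_insert) (auto intro: le_trans)
  then show ?case by simp
qed (use A in simp)

text \<open>The seed \<open>A\<close> is heavy enough to absorb all primes of the class up to 16384;
  beyond that \<open>sum_primes_mod4_ge\<close> admits each new prime.\<close>

lemma covers_primes_mod4:
  assumes a: "a = 1 \<or> a = 3" and L: "2 * L \<le> 1000"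
    and A: "covers L A" "A \<subseteq> primes_mod4 a 16384" "16384 + 2 * L \<le> \<Sum>A"
    and x: "16384 \<le> x"
  shows "covers L (primes_mod4 a x)"
  using x
proof (induction x rule: dec_induct)
  case base
  have "covers L (A \<union> primes_mod4 a 16384)"
    using A by (intro covers_Un) (auto simp: primes_mod4_def)
  then show ?case using A by (simp add: Un_absorb1)
next
  case (step x)
  show ?case
  proof (cases "prime (Suc x) \<and> Suc x mod 4 = a")
    case True
    then have "primes_mod4 a (Suc x) = insert (Suc x) (primes_mod4 a x)"
      by (auto simp: primes_mod4_def le_Suc_eq)
    moreover have "2 * L + Suc x \<le> Suc (\<Sum>(primes_mod4 a x))"
      using sum_primes_mod4_ge [OF a, of x] step L by simp
    ultimately show ?thesis using step covers_insert by simp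
  next
    case False
    then have "primes_mod4 a (Suc x) = primes_mod4 a x"
      by (auto simp: primes_mod4_def le_Suc_eq)
    then show ?thesis using step by simp
  qed
qed

lemma sum_of_distinct_primes_mod4:
  assumes a: "a = 1 \<or> a = 3" and L: "0 < L" "2 * L \<le> 1000"
    and A: "covers L A" "A \<subseteq> primes_mod4 a 16384" "16384 + 2 * L \<le> \<Sum>A"
    and m: "L \<le> m"
  shows "\<exists>P. finite P \<and> P \<noteq> {} \<and> (\<forall>p\<in>P. prime p \<and> p mod 4 = a) \<and> \<Sum>P = m"
proof -
  \<comment> \<open>Taking \<open>x\<close> at least \<open>m\<close> puts the upper end of the
    interval beyond \<open>m\<close>.\<close>
  define x where "x = max 16384 m"
  have "covers L (primes_mod4 a x)"
    using a L(2) A by (rule covers_primes_mod4) (simp add: x_def)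
  moreover have "m + L \<le> \<Sum>(primes_mod4 a x)"
    using sum_primes_mod4_ge [OF a, of x] L by (simp add: x_def)
  ultimately obtain P where P: "P \<subseteq> primes_mod4 a x" "\<Sum>P = m"
    using m by (auto simp: covers_def)
  then show ?thesis
    using m L by (intro exI [of _ P]) (auto simp: primes_mod4_def intro: finite_subset [OF P(1)])
qed

section \<open>Certified subset-sum computation\<close>

text \<open>
  Entry \<open>i\<close> of a table records whether \<open>i\<close> is a known subset sum. The recursion is tail-recursive
  because rewriting would otherwise unfold the table twice for each summand.
\<close>
definition add_summand :: "nat \<Rightarrow> bool list \<Rightarrow> bool list" where
  "add_summand p t = map2 (\<or>) t (replicate p False @ t)"

primrec subset_sum_table :: "nat list \<Rightarrow> bool list \<Rightarrow> bool list" where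
  "subset_sum_table [] t = t"
| "subset_sum_table (p # ps) t = subset_sum_table ps (add_summand p t)"

lemma length_subset_sum_table [simp]: "length (subset_sum_table ps t) = length t"
  by (induction ps arbitrary: t) (simp_all add: add_summand_def)

text \<open>Each processed summand moves from \<open>ps\<close> into \<open>A\<close>; distinctness
  and disjointness ensure that it is used at most once.\<close>

lemma subset_sum_table_sound:
  assumes "distinct ps" "set ps \<inter> A = {}" "finite A"
    and "\<And>i. i < length t \<Longrightarrow> t ! i \<Longrightarrow> i \<in> Sum ` Pow A"
    and "i < length t" "subset_sum_table ps t ! i"
  shows "i \<in> Sum ` Pow (set ps \<union> A)"
  using assms
proof (induction ps arbitrary: t A)
  case (Cons p ps)
  have "j \<in> Sum ` Pow (insert p A)" if j: "j < length t" "add_summand p t ! j" for j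
  proof -
    consider "t ! j" | "p \<le> j" "t ! (j - p)"
      using j by (auto simp: add_summand_def nth_append split: if_splits)
    then show ?thesis
    proof cases
      case 1
      then have "j \<in> Sum ` Pow A" using Cons.prems j by simp
      then show ?thesis by auto
    next
      case 2
      then have "j - p \<in> Sum ` Pow A" using Cons.prems j by simp
      then obtain P where P: "P \<subseteq> A" "\<Sum>P = j - p" by auto
      then have "\<Sum>(insert p P) = j"
        using Cons.prems 2 by (subst sum.insert) (auto intro: finite_subset)
      with P show ?thesis by (intro image_eqI [of _ _ "insert p P"]) auto
    qed
  qed
  then have "i \<in> Sum ` Pow (set ps \<union> insert p A)"
    using Cons.prems by (intro Cons.IH [of _ "add_summand p t"]) (auto simp: add_summand_def)
  then show ?case by simp
qed simp

text \<open>The bound on \<open>sum_list ps\<close> makes the table reach the upper end of the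
  interval. The initial table marks 0, the sum of the empty set.\<close>

lemma covers_set:
  assumes ps: "distinct ps" "sum_list ps \<le> n + L"
    and table: "list_all id (drop L (subset_sum_table ps (True # replicate n False)))"
  shows "covers L (set ps)"
proof -
  have "m \<in> Sum ` Pow (set ps)" if m: "L \<le> m" "m + L \<le> \<Sum>(set ps)" for m
  proof -
    have "m \<le> n" using m ps by (simp add: distinct_sum_list_conv_Sum)
    have "\<forall>j<Suc n - L. subset_sum_table ps (True # replicate n False) ! (L + j)"
      using table by (simp add: list_all_length)
    from this [rule_format, of "m - L"]
    have "subset_sum_table ps (True # replicate n False) ! m"
      using m \<open>m \<le> n\<close> by simp
    then have "m \<in> Sum ` Pow (set ps \<union> {})"
      using ps m \<open>m \<le> n\<close>
      by (intro subset_sum_table_sound [of _ _ "True # replicate n False"])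
        (auto simp: nth_Cons split: nat.splits)
    then show ?thesis by simp
  qed
  then show ?thesis by (simp add: covers_def)
qed

section \<open>Primality by trial division\<close>

text \<open>In a proper factorization one factor is below \<open>r\<close>. The disjunct
  \<open>d = p\<close> lets primes below \<open>r\<close> pass, so one \<open>r\<close> serves a
  whole list.\<close>

lemma prime_nat_if_no_small_divisor:
  fixes p r :: nat
  assumes "1 < p" "p < r * r" "list_all (\<lambda>d. p mod d \<noteq> 0 \<or> d = p) [2..<r]"
  shows "prime p"
proof -
  have small: "p \<le> d" if "1 < d" "d < r" "d dvd p" for d
    using assms(3) that by (force simp: list_all_iff)
  have "m = p" if "m dvd p" "m \<noteq> 1" for m
  proof (rule ccontr)
    assume "m \<noteq> p"
    obtain e where e: "p = m * e" using \<open>m dvd p\<close> by blast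
    have "m \<noteq> 0" "e \<noteq> 0" "e \<noteq> 1"
      using e assms(1) \<open>m \<noteq> p\<close> by (metis mult_0 not_less_zero, metis mult_0_right not_less_zero, metis mult_1_right)
    then have "1 < m" "1 < e" using \<open>m \<noteq> 1\<close> by linarith+
    then have "m < p" "e < p" using e by simp_all
    have "\<not> (r \<le> m \<and> r \<le> e)"
      using assms(2) e mult_le_mono [of r m r e] by linarith
    moreover have "m dvd p" "e dvd p" using e by simp_all
    ultimately have "p \<le> m \<or> p \<le> e"
      using small [of m] small [of e] \<open>1 < m\<close> \<open>1 < e\<close> by linarith
    with \<open>m < p\<close> \<open>e < p\<close> show False by simp
  qed
  then show ?thesis using assms(1) by (auto simp: prime_nat_iff)
qed

lemma set_subset_primes_mod4:
  assumes "list_all (\<lambda>p. 1 < p \<and> p < r * r \<and> p mod 4 = a \<and> p \<le> x \<and>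
    list_all (\<lambda>d. p mod d \<noteq> 0 \<or> d = p) [2..<r]) ps"
  shows "set ps \<subseteq> primes_mod4 a x"
proof
  fix p assume "p \<in> set ps"
  then have p: "1 < p" "p < r * r" "p mod 4 = a" "p \<le> x"
      "list_all (\<lambda>d. p mod d \<noteq> 0 \<or> d = p) [2..<r]"
    using assms by (simp_all add: list_all_iff)
  then have "prime p" by (intro prime_nat_if_no_small_divisor)
  with p show "p \<in> primes_mod4 a x" by (simp add: primes_mod4_def)
qed

lemma covers_append:
  assumes ps: "covers L (set ps)" "distinct ps"
    and ts: "list_all (\<lambda>t. 2 * L + t \<le> Suc (sum_list ps)) ts"
  shows "covers L (set (ps @ ts))"
proof -
  have "covers L (set ps \<union> set ts)"
    using ps(1)
  proof (rule covers_Un)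
    fix t assume "t \<in> set ts"
    then show "2 * L + t \<le> Suc (\<Sum>(set ps))"
      using ts ps(2) by (auto simp: list_all_iff distinct_sum_list_conv_Sum)
  qed simp
  then show ?thesis by simp
qed

section \<open>Seeds for the two residue classes\<close>

lemma sum_of_distinct_primes_1_mod_4:
  fixes m :: nat
  assumes "122 \<le> m"
  shows "\<exists>P. finite P \<and> P \<noteq> {} \<and> (\<forall>p\<in>P. prime p \<and> p mod 4 = 1) \<and> \<Sum>P = m"
proof -
  \<comment> \<open>\<open>ps\<close> has sum 725, so \<open>ts\<close> may go up to
    \<open>726 - 244 = 482\<close>; the sum becomes 3756 and \<open>us\<close> may go up to
    3513.\<close>
  define ps :: "nat list" where "ps = [5, 13, 17, 29, 37, 41, 53, 61, 73, 89, 97, 101, 109]"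
  define ts :: "nat list" where "ts = [401, 409, 421, 433, 449, 457, 461]"
  define us :: "nat list" where "us = [3433, 3449, 3457, 3461, 3469]"
  \<comment> \<open>The last index is \<open>603 = 725 - 122\<close>.\<close>
  have "list_all id (drop 122 (subset_sum_table ps (True # replicate 603 False)))"
    unfolding ps_def by code_simp
  then have "covers 122 (set ps)"
    by (rule covers_set [rotated 2]) (simp_all add: ps_def)
  then have "covers 122 (set (ps @ ts))"
    by (rule covers_append) (simp_all add: ps_def ts_def)
  then have "covers 122 (set ((ps @ ts) @ us))"
    by (rule covers_append) (simp_all add: ps_def ts_def us_def)
  moreover have "set ((ps @ ts) @ us) \<subseteq> primes_mod4 1 16384"
    \<comment> \<open>\<open>59^2 = 3481\<close> exceeds every listed prime.\<close>
    by (rule set_subset_primes_mod4 [where r = 59]) (simp add: ps_def ts_def us_def)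
  moreover have "16384 + 2 * 122 \<le> \<Sum>(set ((ps @ ts) @ us))"
    by (simp add: ps_def ts_def us_def)
  ultimately show ?thesis
    using assms by (intro sum_of_distinct_primes_mod4 [of 1 122]) simp_all
qed

lemma sum_of_distinct_primes_3_mod_4:
  fixes m :: nat
  assumes "56 \<le> m"
  shows "\<exists>P. finite P \<and> P \<noteq> {} \<and> (\<forall>p\<in>P. prime p \<and> p mod 4 = 3) \<and> \<Sum>P = m"
proof -
  \<comment> \<open>Here the sums are 460 and then 2573, giving the last index
    \<open>404 = 460 - 56\<close> and the limits 349 for \<open>ts\<close> and 2462 for
    \<open>us\<close>.\<close>
  define ps :: "nat list" where "ps = [3, 7, 11, 19, 23, 31, 43, 47, 59, 67, 71, 79]"
  define ts :: "nat list" where "ts = [263, 271, 283, 307, 311, 331, 347]"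
  define us :: "nat list" where "us = [2383, 2399, 2411, 2423, 2447, 2459]"
  have "list_all id (drop 56 (subset_sum_table ps (True # replicate 404 False)))"
    unfolding ps_def by code_simp
  then have "covers 56 (set ps)"
    by (rule covers_set [rotated 2]) (simp_all add: ps_def)
  then have "covers 56 (set (ps @ ts))"
    by (rule covers_append) (simp_all add: ps_def ts_def)
  then have "covers 56 (set ((ps @ ts) @ us))"
    by (rule covers_append) (simp_all add: ps_def ts_def us_def)
  moreover have "set ((ps @ ts) @ us) \<subseteq> primes_mod4 3 16384"
    by (rule set_subset_primes_mod4 [where r = 59]) (simp add: ps_def ts_def us_def)
  moreover have "16384 + 2 * 56 \<le> \<Sum>(set ((ps @ ts) @ us))"
    by (simp add: ps_def ts_def us_def)
  ultimately show ?thesis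
    using assms by (intro sum_of_distinct_primes_mod4 [of 3 56]) simp_all
qed

theorem theorem2p5:
  shows "(\<forall>m::nat. m \<ge> 122 \<longrightarrow>
            (\<exists>P::nat set. finite P \<and> P \<noteq> {} \<and>
               (\<forall>p\<in>P. prime p \<and> p mod 4 = 1) \<and> \<Sum>P = m))
       \<and> (\<forall>m::nat. m \<ge> 56 \<longrightarrow>
            (\<exists>Q::nat set. finite Q \<and> Q \<noteq> {} \<and>
               (\<forall>q\<in>Q. prime q \<and> q mod 4 = 3) \<and> \<Sum>Q = m))"
  using sum_of_distinct_primes_1_mod_4 sum_of_distinct_primes_3_mod_4 by blast

end
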